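(* There is a recursively enumerable set $A \subseteq \mathbb{N}$ which is complex, i.e., there is a constant $c$ such that $C(\chi_A \restriction n) \geq 2\log n - c$ for infinitely many $n \in \mathbb{N}$.
   Context: $\log$ denotes the logarithm to base 2. $\lambda$ is the empty string, $l(p)$ is the length of a string $p \in \{0,1\}^*$, and $\perp$ is a special symbol. For a partial recursive mapping $V : \{0,1\}^* \times \{0,1\}^* \to \{0,1\}^* \cup \{\perp\}$ and $x \in \{0,1\}^*$, let $C_V(x) = \min\{ l(p) : V(p,\lambda) = x \}$ (and $C_V(x) = \infty$ if no such $p$ exists). Fix an optimal partial recursive mapping $U : \{0,1\}^* \times \{0,1\}^* \to \{0,1\}^* \cup \{\perp\}$, i.e., one such that for every partial recursive mapping $V : \{0,1\}^* \times \{0,1\}^* \to \{0,1\}^* \cup \{\perp\}$ there is a constant $d$ with $C_U(x) \leq C_V(x) + d$ for all $x$. Write $C(x) = C_U(x)$ (the Kolmogorov complexity of $x$). For $A \subseteq \mathbb{N}$ with characteristic function $\chi_A$ and $n \in \mathbb{N}$, $\chi_A \restriction n$ denotes the string $\chi_A(0)\chi_A(1)\cdots\chi_A(n)$ of length $n+1$. *)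

theory Defs
  imports Complex_Main "HOL-Library.Extended_Nat" "HOL-Library.Extended_Real"
begin

section \<open>Partial recursive functions\<close>

text \<open>
  Kleene's schemes on the natural numbers. Arities are not part of the terms: a term is applied to
  an argument list, and an application to a list of unsuitable length is undefined. On lists of
  a fixed length \<open>k\<close> the terms thus yield exactly the \<open>k\<close>-ary partial recursive functions.
\<close>

datatype recf =
    Zero
  | Succ
  | Proj nat
  | Comp recf "recf list"
  | PrimRec recf recf
  | Mu recf

text \<open>
  \<^const>\<open>None\<close> means ``undefined''. Composition is strict in all inner functions, and the search
  \<open>Mu f\<close> requires \<open>f\<close> to be defined (and nonzero) at all values below the first zero.
\<close>

fun recf_val :: "recf \<Rightarrow> nat list \<Rightarrow> nat option" where
  "recf_val Zero xs = Some 0"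
| "recf_val Succ xs = (case xs of [x] \<Rightarrow> Some (Suc x) | _ \<Rightarrow> None)"
| "recf_val (Proj i) xs = (if i < length xs then Some (xs ! i) else None)"
| "recf_val (Comp f gs) xs = Option.bind (those (map (\<lambda>g. recf_val g xs) gs)) (recf_val f)"
| "recf_val (PrimRec f g) xs =
     (case xs of
        [] \<Rightarrow> None
      | n # ys \<Rightarrow>
          rec_nat (recf_val f ys) (\<lambda>m r. Option.bind r (\<lambda>y. recf_val g (m # y # ys))) n)"
| "recf_val (Mu f) xs =
     (if \<exists>n. recf_val f (n # xs) = Some 0 \<and> (\<forall>m<n. \<exists>y. recf_val f (m # xs) = Some (Suc y))
      then Some (LEAST n. recf_val f (n # xs) = Some 0)
      else None)"

definition recursively_enumerable :: "nat set \<Rightarrow> bool" where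
  "recursively_enumerable A \<longleftrightarrow> (\<exists>e. A = {n. recf_val e [n] \<noteq> None})"

section \<open>Partial recursive mappings on strings\<close>

text \<open>The values in \<open>{0,1}\<^sup>* \<union> {\<bottom>}\<close>; the symbol \<open>\<bottom>\<close> is a proper value, not divergence.\<close>

datatype outcome = Bot | Str "bool list"

text \<open>The bijective base-2 numeration of strings, least significant digit first.\<close>

fun string_code :: "bool list \<Rightarrow> nat" where
  "string_code [] = 0"
| "string_code (b # p) = 2 * string_code p + (if b then 2 else 1)"

fun outcome_code :: "outcome \<Rightarrow> nat" where
  "outcome_code Bot = 0"
| "outcome_code (Str x) = Suc (string_code x)"

definition partial_recursive :: "(bool list \<times> bool list \<rightharpoonup> outcome) \<Rightarrow> bool" where
  "partial_recursive V \<longleftrightarrow>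
     (\<exists>e. \<forall>p q. recf_val e [string_code p, string_code q] = map_option outcome_code (V (p, q)))"

section \<open>Kolmogorov complexity\<close>

text \<open>On \<^typ>\<open>enat\<close>, \<^const>\<open>Inf\<close> is the minimum of a nonempty set, and \<open>\<infinity>\<close> for the empty set.\<close>

definition complexity :: "(bool list \<times> bool list \<rightharpoonup> outcome) \<Rightarrow> bool list \<Rightarrow> enat" where
  "complexity V x = Inf {enat (length p) | p. V (p, []) = Some (Str x)}"

definition optimal :: "(bool list \<times> bool list \<rightharpoonup> outcome) \<Rightarrow> bool" where
  "optimal U \<longleftrightarrow> partial_recursive U \<and>
     (\<forall>V. partial_recursive V \<longrightarrow>
        (\<exists>d::nat. \<forall>x. complexity U x \<le> complexity V x + enat d))"

text \<open>The initial segment includes position \<open>n\<close>, so it has length \<open>n + 1\<close>.\<close>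

definition char_prefix :: "nat set \<Rightarrow> nat \<Rightarrow> bool list" where
  "char_prefix A n = map (\<lambda>i. i \<in> A) [0..<Suc n]"

end

(*
  Split the positions into blocks [2L, 4L) with L = 2^k. On each block, A is an initial segment
  of at most L elements: 2L + j is enumerated once, for every j' <= j and every n in [3L, 4L),
  some program of length less than 2k is found to output a string of length n + 1 whose bits from
  2L onwards read 1^j' 0^(L - j'). The L * L pairs (n, j') would require different programs, but
  there are only L * L - 1 programs of length less than 2k. Hence the enumeration stops within each
  block, and then some prefix ending in [3L, 4L) has complexity at least 2k, which is at least
  2 log n - 4. The bits below 2L are not constrained, so the blocks do not interact. For the
  enumerability of A, every partial recursive function is approximated, by recursion on its
  definition, by total functions with a step bound.
*)
theory Submission
  imports Defs
begin

section \<open>Total recursive functions\<close>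

text \<open>Only lists of length \<open>k\<close> matter, so any function on lists, written with
  \<open>hd\<close>, \<open>tl\<close> and \<open>!\<close>, can stand for a \<open>k\<close>-ary
  function.\<close>

definition total_recursive :: "nat \<Rightarrow> (nat list \<Rightarrow> nat) \<Rightarrow> bool" where
  "total_recursive k f \<longleftrightarrow> (\<exists>e. \<forall>xs. length xs = k \<longrightarrow> recf_val e xs = Some (f xs))"

text \<open>Tuples of functions, the inner part of a composition: an argument list such as
  \<open>hd ys # tl (tl ys)\<close> is then itself recursive in \<open>ys\<close>.\<close>

definition total_recursive_list :: "nat \<Rightarrow> nat \<Rightarrow> (nat list \<Rightarrow> nat list) \<Rightarrow> bool" where
  "total_recursive_list k m G \<longleftrightarrow>
     (\<forall>xs. length xs = k \<longrightarrow> length (G xs) = m) \<and> (\<forall>i<m. total_recursive k (\<lambda>xs. G xs ! i))"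

definition decidable :: "nat \<Rightarrow> (nat list \<Rightarrow> bool) \<Rightarrow> bool" where
  "decidable k P \<longleftrightarrow> total_recursive k (\<lambda>xs. of_bool (P xs))"

lemma total_recursive_cong:
  assumes "total_recursive k f" "\<And>xs. length xs = k \<Longrightarrow> f xs = g xs"
  shows "total_recursive k g"
  using assms unfolding total_recursive_def by metis

lemma total_recursive_nth: "i < k \<Longrightarrow> total_recursive k (\<lambda>xs. xs ! i)"
  unfolding total_recursive_def by (rule exI[of _ "Proj i"]) auto

lemma total_recursive_list_id: "total_recursive_list k k (\<lambda>xs. xs)"
  by (simp add: total_recursive_list_def total_recursive_nth)

lemma total_recursive_list_Nil: "total_recursive_list k 0 (\<lambda>xs. [])"
  by (simp add: total_recursive_list_def)

lemma total_recursive_list_Cons: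
  assumes "total_recursive k g" "total_recursive_list k m G"
  shows "total_recursive_list k (Suc m) (\<lambda>xs. g xs # G xs)"
  using assms by (auto simp: total_recursive_list_def less_Suc_eq_0_disj)

lemma total_recursive_list_tl:
  assumes "total_recursive_list k (Suc m) G"
  shows "total_recursive_list k m (\<lambda>xs. tl (G xs))"
  unfolding total_recursive_list_def
proof (intro conjI allI impI)
  fix i assume "i < m"
  then have "total_recursive k (\<lambda>xs. G xs ! Suc i)"
    using assms by (simp add: total_recursive_list_def)
  then show "total_recursive k (\<lambda>xs. tl (G xs) ! i)"
    by (rule total_recursive_cong)
      (use assms \<open>i < m\<close> in \<open>auto simp: total_recursive_list_def nth_tl\<close>)
qed (use assms in \<open>auto simp: total_recursive_list_def\<close>)

lemma total_recursive_hd: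
  assumes "total_recursive_list k (Suc m) G"
  shows "total_recursive k (\<lambda>xs. hd (G xs))"
proof -
  have "total_recursive k (\<lambda>xs. G xs ! 0)"
    using assms by (simp add: total_recursive_list_def)
  then show ?thesis
    by (rule total_recursive_cong)
      (use assms in \<open>metis hd_conv_nth list.size(3) nat.distinct(1) total_recursive_list_def\<close>)
qed

lemma total_recursive_list_map:
  assumes "\<And>g. g \<in> set gs \<Longrightarrow> total_recursive k g"
  shows "total_recursive_list k (length gs) (\<lambda>xs. map (\<lambda>g. g xs) gs)"
  using assms by (auto simp: total_recursive_list_def)

lemma those_map_eq_Some:
  "those (map f xs) = Some (map g xs)" if "\<And>x. x \<in> set xs \<Longrightarrow> f x = Some (g x)"
  using that by (induction xs) auto

lemma those_eq_Some_iff: "those xs = Some ys \<longleftrightarrow> xs = map Some ys"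
proof (induction xs arbitrary: ys)
  case (Cons x xs)
  then show ?case by (cases ys; cases x) auto
qed auto

lemma total_recursive_compose:
  assumes "total_recursive m F" "total_recursive_list k m G"
  shows "total_recursive k (\<lambda>xs. F (G xs))"
proof -
  obtain f where f: "\<And>xs. length xs = m \<Longrightarrow> recf_val f xs = Some (F xs)"
    using assms(1) by (auto simp: total_recursive_def)
  have "\<forall>i<m. \<exists>e. \<forall>xs. length xs = k \<longrightarrow> recf_val e xs = Some (G xs ! i)"
    using assms(2) by (simp add: total_recursive_list_def total_recursive_def)
  then obtain h where h: "\<And>i xs. i < m \<Longrightarrow> length xs = k \<Longrightarrow> recf_val (h i) xs = Some (G xs ! i)"
    by metis
  have len: "length (G xs) = m" if "length xs = k" for xs
    using assms(2) that by (simp add: total_recursive_list_def)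
  have "recf_val (Comp f (map h [0..<m])) xs = Some (F (G xs))" if "length xs = k" for xs
  proof -
    have "those (map (\<lambda>g. recf_val g xs) (map h [0..<m])) = Some (map (\<lambda>i. G xs ! i) [0..<m])"
      unfolding map_map by (rule those_map_eq_Some) (simp add: h that)
    also have "map (\<lambda>i. G xs ! i) [0..<m] = G xs"
      using len[OF that] map_nth by blast
    finally show ?thesis using f len that by simp
  qed
  then show ?thesis unfolding total_recursive_def by blast
qed

lemma total_recursive_Suc:
  assumes "total_recursive k f"
  shows "total_recursive k (\<lambda>xs. Suc (f xs))"
proof -
  have "total_recursive (Suc 0) (\<lambda>xs. Suc (hd xs))"
    unfolding total_recursive_def
    by (rule exI[of _ Succ]) (auto split: list.split)
  from total_recursive_compose[OF this
      total_recursive_list_Cons[OF assms total_recursive_list_Nil]]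
  show ?thesis by simp
qed

lemma total_recursive_const: "total_recursive k (\<lambda>xs. c)"
proof (induction c)
  case 0
  show ?case unfolding total_recursive_def by (rule exI[of _ Zero]) auto
qed (rule total_recursive_Suc)

text \<open>Bound variables become the first entries of the argument list, as in de Bruijn notation.\<close>

lemma total_recursive_rec_nat:
  assumes "total_recursive k N" "total_recursive k B"
    and "total_recursive (Suc (Suc k)) (\<lambda>ys. G (hd ys) (hd (tl ys)) (tl (tl ys)))"
  shows "total_recursive k (\<lambda>xs. rec_nat (B xs) (\<lambda>m r. G m r xs) (N xs))"
proof -
  obtain b where b: "\<And>xs. length xs = k \<Longrightarrow> recf_val b xs = Some (B xs)"
    using assms(2) by (auto simp: total_recursive_def)
  obtain g where g: "\<And>ys. length ys = Suc (Suc k) \<Longrightarrow>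
      recf_val g ys = Some (G (hd ys) (hd (tl ys)) (tl (tl ys)))"
    using assms(3) by (auto simp: total_recursive_def)
  have rec: "rec_nat (recf_val b xs) (\<lambda>m r. Option.bind r (\<lambda>y. recf_val g (m # y # xs))) n =
      Some (rec_nat (B xs) (\<lambda>m r. G m r xs) n)" if "length xs = k" for xs n
    using that by (induction n) (simp_all add: b g)
  \<comment> \<open>\<open>PrimRec\<close> recurses on the head of its list, so the counter is first
    a separate argument; composition then substitutes \<open>N xs\<close> for it.\<close>
  have "total_recursive (Suc k) (\<lambda>ys. rec_nat (B (tl ys)) (\<lambda>m r. G m r (tl ys)) (hd ys))"
    unfolding total_recursive_def
    by (rule exI[of _ "PrimRec b g"]) (auto simp: length_Suc_conv rec)
  from total_recursive_compose[OF this
      total_recursive_list_Cons[OF assms(1) total_recursive_list_id]]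
  show ?thesis by simp
qed

lemmas total_recursive_vars =
  total_recursive_list_id total_recursive_list_Nil total_recursive_list_Cons
  total_recursive_list_tl total_recursive_hd total_recursive_const total_recursive_Suc

text \<open>Weakening: a function of the outer arguments remains recursive under one more bound
  variable.\<close>

lemma total_recursive_tl:
  assumes "total_recursive k f"
  shows "total_recursive (Suc k) (\<lambda>xs. f (tl xs))"
  by (rule total_recursive_compose[OF assms]) (intro total_recursive_vars)

section \<open>Arithmetic operations by primitive recursion\<close>

lemma total_recursive_add:
  assumes "total_recursive k f" "total_recursive k g"
  shows "total_recursive k (\<lambda>xs. f xs + g xs)"
proof -
  have *: "rec_nat x (\<lambda>m r. Suc r) y = x + y" for x y :: nat
    by (induction y) auto
  have "total_recursive k (\<lambda>xs. rec_nat (f xs) (\<lambda>m r. Suc r) (g xs))"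
    by (intro total_recursive_rec_nat assms total_recursive_vars) (rule total_recursive_list_id)+
  then show ?thesis unfolding * .
qed

lemma total_recursive_mult:
  assumes "total_recursive k f" "total_recursive k g"
  shows "total_recursive k (\<lambda>xs. f xs * g xs)"
proof -
  have *: "rec_nat 0 (\<lambda>m r. r + x) y = x * y" for x y :: nat
    by (induction y) auto
  have "total_recursive k (\<lambda>xs. rec_nat 0 (\<lambda>m r. r + f xs) (g xs))"
    by (intro total_recursive_rec_nat assms total_recursive_vars total_recursive_add
        total_recursive_tl) (rule total_recursive_list_id)+
  then show ?thesis unfolding * .
qed

lemma total_recursive_power:
  assumes "total_recursive k f" "total_recursive k g"
  shows "total_recursive k (\<lambda>xs. f xs ^ g xs)"
proof -
  have *: "rec_nat 1 (\<lambda>m r. r * x) y = x ^ y" for x y :: nat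
    by (induction y) auto
  have "total_recursive k (\<lambda>xs. rec_nat 1 (\<lambda>m r. r * f xs) (g xs))"
    by (intro total_recursive_rec_nat assms total_recursive_vars total_recursive_mult
        total_recursive_tl) (rule total_recursive_list_id)+
  then show ?thesis unfolding * .
qed

text \<open>Truncated subtraction iterates the predecessor, which is a recursion that returns its
  counter and discards the previous value.\<close>

lemma total_recursive_diff:
  assumes "total_recursive k f" "total_recursive k g"
  shows "total_recursive k (\<lambda>xs. f xs - g xs)"
proof -
  have pred: "rec_nat 0 (\<lambda>m r. m) x = x - 1" for x :: nat
    by (cases x) auto
  have diff: "rec_nat x (\<lambda>m r. rec_nat 0 (\<lambda>m r. m) r) y = x - y" for x y :: nat
    by (induction y) (auto simp: pred)
  have "total_recursive k (\<lambda>xs. rec_nat (f xs) (\<lambda>m r. rec_nat 0 (\<lambda>m r. m) r) (g xs))"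
    by (intro total_recursive_rec_nat assms total_recursive_vars) (rule total_recursive_list_id)+
  then show ?thesis unfolding diff .
qed

section \<open>Decidable predicates, bounded sums and bounded quantifiers\<close>

lemma decidable_le:
  assumes "total_recursive k f" "total_recursive k g"
  shows "decidable k (\<lambda>xs. f xs \<le> g xs)"
proof -
  have *: "1 - (x - y) = of_bool (x \<le> y)" for x y :: nat
    by auto
  have "total_recursive k (\<lambda>xs. 1 - (f xs - g xs))"
    by (intro assms total_recursive_vars total_recursive_diff)
  then show ?thesis unfolding * decidable_def .
qed

lemma decidable_not:
  assumes "decidable k P"
  shows "decidable k (\<lambda>xs. \<not> P xs)"
proof -
  have *: "1 - of_bool p = (of_bool (\<not> p) :: nat)" for p
    by auto
  have "total_recursive k (\<lambda>xs. 1 - of_bool (P xs))"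
    using assms unfolding decidable_def by (intro total_recursive_vars total_recursive_diff)
  then show ?thesis unfolding * decidable_def .
qed

lemma decidable_conj:
  assumes "decidable k P" "decidable k Q"
  shows "decidable k (\<lambda>xs. P xs \<and> Q xs)"
  using total_recursive_mult[OF assms[unfolded decidable_def]]
  by (simp add: decidable_def of_bool_conj)

lemma decidable_less:
  assumes "total_recursive k f" "total_recursive k g"
  shows "decidable k (\<lambda>xs. f xs < g xs)"
  using decidable_not[OF decidable_le[OF assms(2,1)]] by (simp add: not_le)

lemma decidable_eq:
  assumes "total_recursive k f" "total_recursive k g"
  shows "decidable k (\<lambda>xs. f xs = g xs)"
  using decidable_conj[OF decidable_le[OF assms] decidable_le[OF assms(2,1)]]
  by (simp add: order_eq_iff)

lemma decidable_iff:
  assumes "decidable k P" "decidable k Q"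
  shows "decidable k (\<lambda>xs. P xs \<longleftrightarrow> Q xs)"
  using decidable_eq[OF assms[unfolded decidable_def]] by (simp add: of_bool_eq_iff)

lemma total_recursive_if:
  assumes "decidable k P" "total_recursive k f" "total_recursive k g"
  shows "total_recursive k (\<lambda>xs. if P xs then f xs else g xs)"
proof -
  have *: "of_bool p * x + of_bool (\<not> p) * y = (if p then x else y)" for p and x y :: nat
    by auto
  have "total_recursive k (\<lambda>xs. of_bool (P xs) * f xs + of_bool (\<not> P xs) * g xs)"
    using assms decidable_not[OF assms(1)] unfolding decidable_def
    by (intro total_recursive_add total_recursive_mult)
  then show ?thesis unfolding * .
qed

lemma total_recursive_sum:
  assumes "total_recursive k N" "total_recursive (Suc k) (\<lambda>ys. F (hd ys) (tl ys))"
  shows "total_recursive k (\<lambda>xs. \<Sum>i<N xs. F i xs)"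
proof -
  have *: "rec_nat 0 (\<lambda>m r. r + f m) n = (\<Sum>i<n. f i)" for f :: "nat \<Rightarrow> nat" and n
    by (induction n) auto
  \<comment> \<open>The step function receives counter, accumulator and parameters; the summand must
    skip the accumulator.\<close>
  have drop: "total_recursive_list (Suc (Suc k)) (Suc k) (\<lambda>ys. hd ys # tl (tl ys))"
    by (intro total_recursive_vars) (rule total_recursive_list_id)
  have "total_recursive (Suc (Suc k)) (\<lambda>ys. F (hd ys) (tl (tl ys)))"
    using total_recursive_compose[OF assms(2) drop] by simp
  then have "total_recursive k (\<lambda>xs. rec_nat 0 (\<lambda>m r. r + F m xs) (N xs))"
    by (intro total_recursive_rec_nat assms total_recursive_vars total_recursive_add)
      (rule total_recursive_list_id)+
  then show ?thesis unfolding * .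
qed

text \<open>A bounded existential holds iff the sum of its characteristic function is
  positive.\<close>

lemma decidable_bex:
  assumes "total_recursive k N" "decidable (Suc k) (\<lambda>ys. P (hd ys) (tl ys))"
  shows "decidable k (\<lambda>xs. \<exists>i<N xs. P i xs)"
proof -
  have *: "0 < (\<Sum>i<n. of_bool (p i) :: nat) \<longleftrightarrow> (\<exists>i<n. p i)" for p and n :: nat
    by (induction n) (auto simp: less_Suc_eq)
  have "decidable k (\<lambda>xs. 0 < (\<Sum>i<N xs. of_bool (P i xs) :: nat))"
    by (intro decidable_less total_recursive_const
        total_recursive_sum[OF assms(1) assms(2)[unfolded decidable_def]])
  then show ?thesis unfolding * .
qed

lemma decidable_ball:
  assumes "total_recursive k N" "decidable (Suc k) (\<lambda>ys. P (hd ys) (tl ys))"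
  shows "decidable k (\<lambda>xs. \<forall>i<N xs. P i xs)"
  using decidable_not[OF decidable_bex[OF assms(1) decidable_not[OF assms(2)]]] by simp

text \<open>A disjunction over a fixed finite list of predicates, used to test whether some inner
  function of a composition is still running.\<close>

lemma decidable_list_ex:
  assumes "\<And>g. g \<in> set gs \<Longrightarrow> decidable k g"
  shows "decidable k (\<lambda>xs. \<exists>g\<in>set gs. g xs)"
  using assms
proof (induction gs)
  case Nil
  show ?case by (simp add: decidable_def total_recursive_const)
next
  case (Cons g gs)
  then have "decidable k (\<lambda>xs. \<not> (\<not> g xs \<and> \<not> (\<exists>g\<in>set gs. g xs)))"
    by (intro decidable_not decidable_conj) auto
  then show ?case by (simp add: disj_imp)
qed

lemmas total_recursive_intros = total_recursive_vars total_recursive_add total_recursive_mult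
  total_recursive_power total_recursive_diff decidable_le decidable_less decidable_eq
  decidable_iff decidable_not decidable_conj total_recursive_if total_recursive_sum
  decidable_bex decidable_ball

text \<open>Bit \<open>m\<close> is set iff the quotient by \<open>2 ^ m\<close> is odd. Stating
  this with bounded quantifiers, sums, products and powers brings it under the closure
  rules.\<close>

lemma bit_nat_iff_bounded:
  "bit y m \<longleftrightarrow> (\<exists>q<Suc y. \<exists>r<2 ^ m. y = r + 2 ^ m * (2 * q + 1))" for y m :: nat
proof
  assume "bit y m"
  then have "odd (y div 2 ^ m)" by (simp add: bit_iff_odd)
  then obtain q where q: "y div 2 ^ m = 2 * q + 1" by (elim oddE)
  have "q \<le> y" using q div_le_dividend[of y "2 ^ m"] by linarith
  moreover have "y = y mod 2 ^ m + 2 ^ m * (2 * q + 1)"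
    using mod_mult_div_eq[of y "2 ^ m"] q by simp
  ultimately show "\<exists>q<Suc y. \<exists>r<2 ^ m. y = r + 2 ^ m * (2 * q + 1)"
    by (metis le_imp_less_Suc mod_less_divisor pos2 zero_less_power)
next
  assume "\<exists>q<Suc y. \<exists>r<2 ^ m. y = r + 2 ^ m * (2 * q + 1)"
  then obtain q r where "r < 2 ^ m" "y = r + 2 ^ m * (2 * q + 1)" by blast
  then have "y div 2 ^ m = 2 * q + 1"
    using div_mult_self2[of "2 ^ m" r "2 * q + 1"] by simp
  then show "bit y m" by (simp add: bit_iff_odd)
qed

lemma decidable_bit:
  assumes "total_recursive k f" "total_recursive k g"
  shows "decidable k (\<lambda>xs. bit (f xs) (g xs))"
  unfolding bit_nat_iff_bounded
  by (intro total_recursive_intros assms total_recursive_tl)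
    (rule total_recursive_list_id)+

text \<open>The set is the domain of an unbounded search for a zero of the characteristic function
  of the negation; since that function is total, the search halts iff a witness exists.\<close>

lemma recursively_enumerable_projection:
  assumes "decidable (Suc (Suc 0)) (\<lambda>xs. R (hd xs) (hd (tl xs)))"
  shows "recursively_enumerable {a. \<exists>s. R s a}"
proof -
  have "total_recursive (Suc (Suc 0)) (\<lambda>xs. of_bool (\<not> R (hd xs) (hd (tl xs))))"
    using decidable_not[OF assms] by (simp add: decidable_def)
  then obtain f where f: "\<And>s a. recf_val f [s, a] = Some (of_bool (\<not> R s a))"
    unfolding total_recursive_def by (metis length_Cons list.sel(1,3) list.size(3))
  have "recf_val (Mu f) [a] \<noteq> None \<longleftrightarrow> (\<exists>s. R s a)" for a
  proof -
    have zero: "recf_val f [s, a] = Some 0 \<longleftrightarrow> R s a"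
      and pos: "(\<exists>y. recf_val f [s, a] = Some (Suc y)) \<longleftrightarrow> \<not> R s a" for s
      by (auto simp: f)
    have "recf_val (Mu f) [a] \<noteq> None \<longleftrightarrow> (\<exists>n. R n a \<and> (\<forall>m<n. \<not> R m a))"
      by (simp add: zero pos)
    also have "\<dots> \<longleftrightarrow> (\<exists>s. R s a)"
      using exists_least_iff[of "\<lambda>s. R s a"] by simp
    finally show ?thesis .
  qed
  then show ?thesis
    unfolding recursively_enumerable_def by (intro exI[of _ "Mu f"]) auto
qed

section \<open>Step-bounded approximations\<close>

text \<open>The value 0 stands for a computation that has not yet halted, and \<open>Suc y\<close> for the result \<open>y\<close>.\<close>

definition approximates :: "nat \<Rightarrow> (nat list \<Rightarrow> nat) \<Rightarrow> recf \<Rightarrow> bool" where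
  "approximates k T e \<longleftrightarrow> total_recursive (Suc k) T \<and>
     (\<forall>xs. length xs = k \<longrightarrow>
        (\<forall>s y. T (s # xs) = Suc y \<longrightarrow> recf_val e xs = Some y) \<and>
        (\<forall>y. recf_val e xs = Some y \<longrightarrow> (\<forall>\<^sub>F s in sequentially. T (s # xs) = Suc y)))"

lemma approximatesI:
  assumes "total_recursive (Suc k) T"
    and "\<And>s xs y. length xs = k \<Longrightarrow> T (s # xs) = Suc y \<Longrightarrow> recf_val e xs = Some y"
    and "\<And>xs y. length xs = k \<Longrightarrow> recf_val e xs = Some y \<Longrightarrow>
      \<forall>\<^sub>F s in sequentially. T (s # xs) = Suc y"
  shows "approximates k T e"
  using assms by (auto simp: approximates_def)

lemma
  assumes "approximates k T e"
  shows approximates_recursive: "total_recursive (Suc k) T"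
    and approximates_sound: "length xs = k \<Longrightarrow> T (s # xs) = Suc y \<Longrightarrow> recf_val e xs = Some y"
    and approximates_complete: "length xs = k \<Longrightarrow> recf_val e xs = Some y \<Longrightarrow>
      \<forall>\<^sub>F s in sequentially. T (s # xs) = Suc y"
  using assms by (auto simp: approximates_def)

text \<open>All inner functions run with the same bound. Each is eventually correct, and finitely
  many eventual statements hold jointly from some bound on.\<close>

lemma approximates_Comp:
  assumes "approximates (length Ts) F f" "list_all2 (approximates k) Ts gs"
  shows "approximates k
    (\<lambda>ys. if \<exists>T\<in>set Ts. T ys = 0 then 0 else F (hd ys # map (\<lambda>T. T ys - 1) Ts)) (Comp f gs)"
proof (rule approximatesI)
  have rec: "total_recursive (Suc k) T" if "T \<in> set Ts" for T
    using assms(2) that by (auto simp: list_all2_conv_all_nth in_set_conv_nth approximates_def)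
  have "total_recursive_list (Suc k) (length (map (\<lambda>T ys. T ys - 1) Ts))
      (\<lambda>ys. map (\<lambda>g. g ys) (map (\<lambda>T ys. T ys - 1) Ts))"
    by (rule total_recursive_list_map)
      (auto intro!: total_recursive_diff total_recursive_const intro: rec)
  then have "total_recursive_list (Suc k) (length Ts) (\<lambda>ys. map (\<lambda>T. T ys - 1) Ts)"
    by (simp add: comp_def)
  note total_recursive_list_Cons[OF total_recursive_hd[OF total_recursive_list_id] this]
  then have "total_recursive (Suc k) (\<lambda>ys. F (hd ys # map (\<lambda>T. T ys - 1) Ts))"
    by (rule total_recursive_compose[OF approximates_recursive[OF assms(1)]])
  moreover have "decidable (Suc k) (\<lambda>ys. \<exists>g\<in>set (map (\<lambda>T ys. T ys = 0) Ts). g ys)"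
    by (rule decidable_list_ex)
      (auto intro!: decidable_eq total_recursive_const intro: rec)
  ultimately show "total_recursive (Suc k)
      (\<lambda>ys. if \<exists>T\<in>set Ts. T ys = 0 then 0 else F (hd ys # map (\<lambda>T. T ys - 1) Ts))"
    by (intro total_recursive_intros) simp
next
  fix s xs y
  assume len: "length xs = k" and
    "(if \<exists>T\<in>set Ts. T (s # xs) = 0 then 0
      else F (hd (s # xs) # map (\<lambda>T. T (s # xs) - 1) Ts)) = Suc y"
  then have nz: "\<And>T. T \<in> set Ts \<Longrightarrow> T (s # xs) \<noteq> 0"
    and F: "F (s # map (\<lambda>T. T (s # xs) - 1) Ts) = Suc y"
    by (auto split: if_splits)
  have "map (\<lambda>g. recf_val g xs) gs = map Some (map (\<lambda>T. T (s # xs) - 1) Ts)"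
    using assms(2) nz len
  proof (induction Ts gs rule: list_all2_induct)
    case (Cons T Ts g gs)
    obtain z where "T (s # xs) = Suc z"
      using Cons.prems(1)[of T] not0_implies_Suc by auto
    then show ?case using Cons by (simp add: approximates_sound)
  qed simp
  then have "those (map (\<lambda>g. recf_val g xs) gs) = Some (map (\<lambda>T. T (s # xs) - 1) Ts)"
    by (simp only: those_eq_Some_iff)
  then show "recf_val (Comp f gs) xs = Some y"
    using approximates_sound[OF assms(1) _ F] by simp
next
  fix xs y
  assume len: "length xs = k" and "recf_val (Comp f gs) xs = Some y"
  then obtain zs where "those (map (\<lambda>g. recf_val g xs) gs) = Some zs" "recf_val f zs = Some y"
    by (auto simp: bind_eq_Some_conv)
  then have zs: "map (\<lambda>g. recf_val g xs) gs = map Some zs" and y: "recf_val f zs = Some y"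
    by (auto simp: those_eq_Some_iff)
  have "\<forall>\<^sub>F s in sequentially. map (\<lambda>T. T (s # xs)) Ts = map Suc zs"
    using assms(2) zs
  proof (induction Ts gs arbitrary: zs rule: list_all2_induct)
    case (Cons T Ts g gs)
    then obtain z zs' where zs: "zs = z # zs'" "recf_val g xs = Some z"
      "map (\<lambda>g. recf_val g xs) gs = map Some zs'"
      by (cases zs) auto
    have "\<forall>\<^sub>F s in sequentially. T (s # xs) = Suc z"
      using Cons.hyps len zs(2) by (auto intro: approximates_complete)
    with Cons.IH[OF zs(3)] show ?case
      by eventually_elim (simp add: zs(1))
  qed simp
  moreover have "length zs = length Ts"
    using zs assms(2) by (metis length_map list_all2_lengthD)
  then have "\<forall>\<^sub>F s in sequentially. F (s # zs) = Suc y"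
    using assms(1) y by (simp add: approximates_complete)
  ultimately show "\<forall>\<^sub>F s in sequentially. (if \<exists>T\<in>set Ts. T (s # xs) = 0 then 0
      else F (hd (s # xs) # map (\<lambda>T. T (s # xs) - 1) Ts)) = Suc y"
  proof eventually_elim
    case (elim s)
    \<comment> \<open>The equation between the mapped lists makes every inner value a
      \<open>Suc\<close>, so no inner approximation is still running.\<close>
    have "T (s # xs) \<noteq> 0" if "T \<in> set Ts" for T
    proof -
      have "T (s # xs) \<in> set (map (\<lambda>T. T (s # xs)) Ts)" using that by auto
      then show ?thesis unfolding elim(1) by auto
    qed
    moreover have "map (\<lambda>T. T (s # xs) - 1) Ts = map (\<lambda>n. n - 1) (map (\<lambda>T. T (s # xs)) Ts)"
      by (simp add: comp_def)
    then have "map (\<lambda>T. T (s # xs) - 1) Ts = zs"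
      unfolding elim(1) by (simp add: comp_def)
    ultimately show ?case using elim(2) by auto
  qed
qed

text \<open>The list is bound, counter, parameters. All calls share the bound; 0 is absorbing, and
  \<open>r - 1\<close> decodes the previous value. Induction on the counter combines the finitely
  many eventual statements.\<close>

lemma approximates_PrimRec:
  assumes "approximates k F f" "approximates (Suc (Suc k)) G g"
  shows "approximates (Suc k)
    (\<lambda>ys. rec_nat (F (hd ys # tl (tl ys)))
       (\<lambda>m r. if r = 0 then 0 else G (hd ys # m # (r - 1) # tl (tl ys))) (hd (tl ys)))
    (PrimRec f g)" (is "approximates _ ?T _")
proof (rule approximatesI)
  show "total_recursive (Suc (Suc k)) ?T"
    by (intro total_recursive_rec_nat total_recursive_intros
        total_recursive_compose[OF approximates_recursive[OF assms(1)]]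
        total_recursive_compose[OF approximates_recursive[OF assms(2)]])
      (rule total_recursive_list_id)+
next
  fix s xs y
  assume "length xs = Suc k" and T: "?T (s # xs) = Suc y"
  then obtain n ys where xs: "xs = n # ys" and len: "length ys = k"
    by (auto simp: length_Suc_conv)
  have "rec_nat (recf_val f ys) (\<lambda>m r. Option.bind r (\<lambda>y. recf_val g (m # y # ys))) n = Some y"
    if "rec_nat (F (s # ys)) (\<lambda>m r. if r = 0 then 0 else G (s # m # (r - 1) # ys)) n = Suc y"
    using that
  proof (induction n arbitrary: y)
    case 0
    then show ?case using assms(1) len by (simp add: approximates_sound)
  next
    case (Suc n)
    obtain z where "rec_nat (F (s # ys)) (\<lambda>m r. if r = 0 then 0 else G (s # m # (r - 1) # ys)) n
        = Suc z" and G: "G (s # n # z # ys) = Suc y"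
      using Suc.prems by (auto simp: gr0_conv_Suc split: if_splits)
    with Suc.IH approximates_sound[OF assms(2) _ G] len show ?case by simp
  qed
  then show "recf_val (PrimRec f g) xs = Some y"
    using T by (simp add: xs cong: if_cong)
next
  fix xs y
  assume "length xs = Suc k" and y: "recf_val (PrimRec f g) xs = Some y"
  then obtain n ys where xs: "xs = n # ys" and len: "length ys = k"
    by (auto simp: length_Suc_conv)
  have "\<forall>\<^sub>F s in sequentially.
      rec_nat (F (s # ys)) (\<lambda>m r. if r = 0 then 0 else G (s # m # (r - 1) # ys)) n = Suc y"
    if "rec_nat (recf_val f ys) (\<lambda>m r. Option.bind r (\<lambda>y. recf_val g (m # y # ys))) n = Some y"
    using that
  proof (induction n arbitrary: y)
    case 0
    then show ?case using assms(1) len by (simp add: approximates_complete)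
  next
    case (Suc n)
    then obtain z where
      "rec_nat (recf_val f ys) (\<lambda>m r. Option.bind r (\<lambda>y. recf_val g (m # y # ys))) n = Some z"
      and z: "recf_val g (n # z # ys) = Some y"
      by (auto simp: bind_eq_Some_conv)
    note Suc.IH[OF this(1)]
    moreover have "\<forall>\<^sub>F s in sequentially. G (s # n # z # ys) = Suc y"
      using assms(2) len z by (simp add: approximates_complete)
    ultimately show ?case by eventually_elim simp
  qed
  then show "\<forall>\<^sub>F s in sequentially. ?T (s # xs) = Suc y"
    using y by (simp add: xs cong: if_cong)
qed

text \<open>At most one \<open>n\<close> is accepted, so the sum is \<open>Suc n\<close> or 0. In
  the encoding, 1 is a zero that has been found, larger values are halted and positive, and 0 below
  a candidate blocks it.\<close>

lemma approximates_Mu: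
  assumes "approximates (Suc k) F f"
  shows "approximates k
    (\<lambda>ys. \<Sum>n<hd ys. if F (hd ys # n # tl ys) = 1 \<and> (\<forall>m<n. 1 < F (hd ys # m # tl ys))
       then Suc n else 0)
    (Mu f)" (is "approximates _ ?T _")
proof (rule approximatesI)
  show "total_recursive (Suc k) ?T"
    by (intro total_recursive_intros total_recursive_compose[OF approximates_recursive[OF assms]])
      (rule total_recursive_list_id)+
next
  fix s xs y
  assume len: "length xs = k" and T: "?T (s # xs) = Suc y"
  define P where "P n \<longleftrightarrow> F (s # n # xs) = 1 \<and> (\<forall>m<n. 1 < F (s # m # xs))" for n
  have T: "(\<Sum>n<s. if P n then Suc n else 0) = Suc y"
    using T by (simp add: P_def)
  have "\<exists>n<s. P n"
  proof (rule ccontr)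
    assume "\<not> ?thesis"
    then have "(\<Sum>n<s. if P n then Suc n else 0) = 0" by (intro sum.neutral) auto
    with T show False by simp
  qed
  then obtain n where n: "n < s" "P n" by blast
  \<comment> \<open>Of two distinct candidates, the smaller would have both value 1 and a value
    above 1.\<close>
  have uniq: "P m \<longleftrightarrow> m = n" for m
    using n(2) unfolding P_def by (metis linorder_neqE_nat less_irrefl)
  have "(\<Sum>n<s. if P n then Suc n else 0) = Suc n"
    unfolding uniq using n(1) by simp
  with T have "P y" using n(2) by simp
  have 0: "recf_val f (y # xs) = Some 0"
    using \<open>P y\<close> len by (intro approximates_sound[OF assms, of _ s]) (auto simp: P_def)
  have pos: "\<exists>z. recf_val f (m # xs) = Some (Suc z)" if "m < y" for m
  proof -
    have "1 < F (s # m # xs)" using \<open>P y\<close> that by (simp add: P_def)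
    then obtain z where "F (s # m # xs) = Suc (Suc z)"
      by (metis One_nat_def less_imp_Suc_add add_Suc)
    then show ?thesis using approximates_sound[OF assms, of "m # xs" s "Suc z"] len by auto
  qed
  have "(LEAST n. recf_val f (n # xs) = Some 0) = y"
  proof (rule Least_equality)
    show "y \<le> m" if "recf_val f (m # xs) = Some 0" for m
      using pos[of m] that by (cases "m < y") auto
  qed (rule 0)
  then show "recf_val (Mu f) xs = Some y" using 0 pos by auto
next
  fix xs y
  assume len: "length xs = k" and "recf_val (Mu f) xs = Some y"
  then have ex: "\<exists>n. recf_val f (n # xs) = Some 0 \<and> (\<forall>m<n. \<exists>y. recf_val f (m # xs) = Some (Suc y))"
    and y: "y = (LEAST n. recf_val f (n # xs) = Some 0)"
    by (auto split: if_splits)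
  obtain n where n: "recf_val f (n # xs) = Some 0"
    "\<And>m. m < n \<Longrightarrow> \<exists>y. recf_val f (m # xs) = Some (Suc y)" using ex by blast
  have "y = n"
    unfolding y
  proof (rule Least_equality)
    show "n \<le> m" if "recf_val f (m # xs) = Some 0" for m
      using n(2)[of m] that by (cases "m < n") auto
  qed (rule n(1))
  have "\<forall>\<^sub>F s in sequentially. F (s # n # xs) = 1"
    using approximates_complete[OF assms _ n(1)] len by simp
  \<comment> \<open>Only the finitely many values below \<open>n\<close> are consulted, so one bound
    eventually serves them all.\<close>
  moreover have "\<forall>\<^sub>F s in sequentially. \<forall>m\<in>{..<n}. 1 < F (s # m # xs)"
  proof (intro eventually_ball_finite ballI)
    fix m assume "m \<in> {..<n}"
    then obtain z where "recf_val f (m # xs) = Some (Suc z)" using n(2) by auto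
    then have "\<forall>\<^sub>F s in sequentially. F (s # m # xs) = Suc (Suc z)"
      using approximates_complete[OF assms] len by simp
    then show "\<forall>\<^sub>F s in sequentially. 1 < F (s # m # xs)" by eventually_elim simp
  qed simp
  moreover have "\<forall>\<^sub>F s in sequentially. n < s" by (rule eventually_gt_at_top)
  ultimately show "\<forall>\<^sub>F s in sequentially. ?T (s # xs) = Suc y"
  proof eventually_elim
    case (elim s)
    have "(F (s # i # xs) = 1 \<and> (\<forall>m<i. 1 < F (s # m # xs))) \<longleftrightarrow> i = n" for i
      using elim(1,2) by (metis lessThan_iff linorder_neqE_nat less_irrefl)
    then show ?case using elim(3) \<open>y = n\<close> by simp
  qed
qed

text \<open>Induction with the arity left free, because subterms are applied at other arities. Where
  \<open>Succ\<close>, \<open>Proj\<close> or \<open>PrimRec\<close> is undefined for reasons of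
  arity, the constant 0 serves.\<close>

lemma approximates_exists: "\<exists>T. approximates k T e"
proof (induction e arbitrary: k)
  case Zero
  have "approximates k (\<lambda>_. 1) Zero"
    by (rule approximatesI) (simp_all add: total_recursive_const)
  then show ?case by blast
next
  case Succ
  show ?case
  proof (cases "k = 1")
    case True
    have "approximates k (\<lambda>ys. Suc (Suc (hd (tl ys)))) Succ"
      unfolding True One_nat_def
      by (rule approximatesI)
        (intro total_recursive_intros, rule total_recursive_list_id, auto simp: length_Suc_conv)
    then show ?thesis by blast
  next
    case False
    have "approximates k (\<lambda>_. 0) Succ"
      by (rule approximatesI) (use False in \<open>auto simp: total_recursive_const split: list.splits\<close>)
    then show ?thesis by blast
  qed
next
  case (Proj i)
  show ?case
  proof (cases "i < k")
    case True
    \<comment> \<open>The index shifts by one because the step bound heads the list; the outer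
      \<open>Suc\<close> marks a halted computation.\<close>
    have "approximates k (\<lambda>ys. Suc (ys ! Suc i)) (Proj i)"
      by (rule approximatesI)
        (use True in \<open>auto intro!: total_recursive_Suc total_recursive_nth\<close>)
    then show ?thesis by blast
  next
    case False
    have "approximates k (\<lambda>_. 0) (Proj i)"
      by (rule approximatesI) (use False in \<open>auto simp: total_recursive_const\<close>)
    then show ?thesis by blast
  qed
next
  case (Comp f gs)
  have "\<forall>g\<in>set gs. \<exists>T. approximates k T g" using Comp.IH(2) by blast
  then obtain H where "\<forall>g\<in>set gs. approximates k (H g) g" by metis
  then have "list_all2 (approximates k) (map H gs) gs"
    by (auto simp: list_all2_conv_all_nth)
  moreover obtain F where "approximates (length (map H gs)) F f" using Comp.IH(1) by metis
  ultimately show ?case using approximates_Comp by blast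
next
  case (PrimRec f g)
  show ?case
  proof (cases k)
    case 0
    have "approximates k (\<lambda>_. 0) (PrimRec f g)"
      by (rule approximatesI) (auto simp: total_recursive_const 0)
    then show ?thesis by blast
  next
    case (Suc k')
    obtain F G where "approximates k' F f" "approximates (Suc (Suc k')) G g"
      using PrimRec.IH by blast
    from approximates_PrimRec[OF this] show ?thesis unfolding Suc by blast
  qed
next
  case (Mu f)
  obtain F where "approximates (Suc k) F f" using Mu.IH by blast
  from approximates_Mu[OF this] show ?case by blast
qed

section \<open>Codes of strings\<close>

text \<open>One plus the bijective code is the ordinary binary numeral with the bits of
  \<open>x\<close> below a leading 1, so bits and length can be read off arithmetically.\<close>

lemma Suc_string_code: "Suc (string_code x) = horner_sum of_bool 2 (x @ [True])"
  by (induction x) auto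

lemma bit_Suc_string_code:
  "bit (Suc (string_code x)) n \<longleftrightarrow> n < length x \<and> x ! n \<or> n = length x"
  by (auto simp: Suc_string_code bit_horner_sum_bit_iff nth_append less_Suc_eq)

lemma string_code_bounds:
  "2 ^ length x \<le> Suc (string_code x)" "Suc (string_code x) < 2 ^ Suc (length x)"
  by (induction x) auto

lemma length_less_iff_string_code: "length x < n \<longleftrightarrow> Suc (string_code x) < 2 ^ n"
proof
  assume "length x < n"
  then have "(2::nat) ^ Suc (length x) \<le> 2 ^ n" by (intro power_increasing) auto
  with string_code_bounds(2)[of x] show "Suc (string_code x) < 2 ^ n" by linarith
next
  assume "Suc (string_code x) < 2 ^ n"
  with string_code_bounds(1)[of x] have "(2::nat) ^ length x < 2 ^ n" by linarith
  then show "length x < n" by simp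
qed

lemma string_code_inject: "string_code x = string_code y \<longleftrightarrow> x = y"
proof (induction x arbitrary: y)
  case Nil
  show ?case by (cases y) auto
next
  case (Cons b x)
  show ?case
  proof (cases y)
    case (Cons c z)
    \<comment> \<open>The code is odd for digit 1 and even for digit 2, so parity determines the
      first bit.\<close>
    have "2 * m + (if b then 2 else 1) = 2 * n + (if c then 2 else 1) \<longleftrightarrow> b = c \<and> m = n"
      for m n :: nat
      by (cases b; cases c; simp; presburger)
    then have "string_code (b # x) = string_code (c # z) \<longleftrightarrow> b = c \<and> string_code x = string_code z"
      by simp
    then show ?thesis using Cons.IH Cons by simp
  qed simp
qed

lemma string_code_surj: "\<exists>x. string_code x = n"
proof (induction n rule: less_induct)
  case (less n)
  show ?case
  proof (cases n)
    case 0
    then show ?thesis by (metis string_code.simps(1))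
  next
    case (Suc m)
    then have "m div 2 < n" by simp
    then obtain x where "string_code x = m div 2" using less by blast
    \<comment> \<open>For \<open>n = Suc m\<close> the leading digit is 2 exactly if
      \<open>m\<close> is odd.\<close>
    then have "string_code (odd m # x) = n" using Suc by (auto elim: oddE)
    then show ?thesis ..
  qed
qed

text \<open>The codes lie below \<open>2 ^ n - 1\<close>; this strictness is the margin for the
  pigeonhole argument.\<close>

lemma card_short_strings: "card {p :: bool list. length p < n} < 2 ^ n"
proof -
  have "string_code ` {p. length p < n} \<subseteq> {..<2 ^ n - 1}"
    by (auto simp: length_less_iff_string_code)
  then have "card {p :: bool list. length p < n} \<le> card {..<(2::nat) ^ n - 1}"
    by (intro card_inj_on_le[where f = string_code]) (auto simp: inj_on_def string_code_inject)
  also have "\<dots> < 2 ^ n" by simp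
  finally show ?thesis .
qed

section \<open>The complex set\<close>

text \<open>Lengths exceed \<open>3 * 2 ^ k\<close>, so the window of \<open>2 ^ k\<close> positions
  from \<open>2 * 2 ^ k\<close> on always lies inside the string.\<close>

definition marked :: "nat \<Rightarrow> nat \<Rightarrow> nat \<Rightarrow> bool list \<Rightarrow> bool" where
  "marked k j i x \<longleftrightarrow> length x = Suc (3 * 2 ^ k + i) \<and> (\<forall>m<2 ^ k. x ! (2 * 2 ^ k + m) \<longleftrightarrow> m < j)"

definition certified :: "(bool list \<times> bool list \<rightharpoonup> outcome) \<Rightarrow> nat \<Rightarrow> nat \<Rightarrow> nat \<Rightarrow> bool" where
  "certified U k j i \<longleftrightarrow> (\<exists>p x. length p < 2 * k \<and> U (p, []) = Some (Str x) \<and> marked k j i x)"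

text \<open>A description without stages: certification does not refer to the set, and quantifying
  over all \<open>j' \<le> j\<close> makes the part in each block an initial segment.\<close>

definition complex_set :: "(bool list \<times> bool list \<rightharpoonup> outcome) \<Rightarrow> nat set" where
  "complex_set U =
     {a. \<exists>k j. j < 2 ^ k \<and> a = 2 * 2 ^ k + j \<and> (\<forall>j'\<le>j. \<forall>i<2 ^ k. certified U k j' i)}"

text \<open>Expresses the condition through the outcome code \<open>Suc (string_code x)\<close>, so
  that it becomes decidable arithmetic.\<close>

lemma marked_iff_bits:
  "marked k j i x \<longleftrightarrow> 2 ^ Suc (3 * 2 ^ k + i) \<le> Suc (string_code x) \<and>
     Suc (string_code x) < 2 ^ Suc (Suc (3 * 2 ^ k + i)) \<and>
     (\<forall>m<2 ^ k. bit (Suc (string_code x)) (2 * 2 ^ k + m) \<longleftrightarrow> m < j)"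
proof -
  let ?l = "Suc (3 * 2 ^ k + i)"
  have len: "length x = ?l \<longleftrightarrow>
      2 ^ ?l \<le> Suc (string_code x) \<and> Suc (string_code x) < 2 ^ Suc ?l"
    using length_less_iff_string_code[of x ?l] length_less_iff_string_code[of x "Suc ?l"]
    by linarith
  have "bit (Suc (string_code x)) (2 * 2 ^ k + m) = x ! (2 * 2 ^ k + m)"
    if "length x = ?l" "m < 2 ^ k" for m
    using that by (auto simp: bit_Suc_string_code)
  then show ?thesis unfolding marked_def using len by auto
qed

text \<open>The length recovers \<open>i\<close>, and the position where the window turns to zeros
  recovers \<open>j\<close>.\<close>

lemma marked_inject:
  assumes "marked k j i x" "marked k j' i' x" "j < 2 ^ k" "j' < 2 ^ k"
  shows "j = j' \<and> i = i'"
proof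
  show "i = i'" using assms by (simp add: marked_def)
  have "m < j \<longleftrightarrow> m < j'" if "m < 2 ^ k" for m
    using assms that by (simp add: marked_def)
  then show "j = j'" using assms(3,4) by (metis linorder_neqE_nat less_irrefl)
qed

text \<open>Pigeonhole: a program has one output, and that output is marked for one pair only, so
  the choice of programs for the pairs is injective.\<close>

lemma uncertified_exists: "\<exists>j<2 ^ k. \<exists>i<2 ^ k. \<not> certified U k j i"
proof (rule ccontr)
  assume "\<not> ?thesis"
  then have "\<forall>z \<in> {..<2 ^ k} \<times> {..<2 ^ k}. \<exists>p x. length p < 2 * k \<and>
      U (p, []) = Some (Str x) \<and> marked k (fst z) (snd z) x"
    by (auto simp: certified_def)
  then obtain P where P: "\<And>z. z \<in> {..<2 ^ k} \<times> {..<2 ^ k} \<Longrightarrow> length (P z) < 2 * k \<and>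
      (\<exists>x. U (P z, []) = Some (Str x) \<and> marked k (fst z) (snd z) x)"
    by metis
  have "inj_on P ({..<2 ^ k} \<times> {..<2 ^ k})"
  proof (rule inj_onI)
    fix z z'
    assume z: "z \<in> {..<2 ^ k} \<times> {..<2 ^ k}" and z': "z' \<in> {..<2 ^ k} \<times> {..<2 ^ k}"
      and "P z = P z'"
    then obtain x where "marked k (fst z) (snd z) x" "marked k (fst z') (snd z') x"
      using P[OF z] P[OF z'] by auto
    then have "fst z = fst z' \<and> snd z = snd z'"
      using z z' by (intro marked_inject) auto
    then show "z = z'" by (simp add: prod_eq_iff)
  qed
  moreover have "P ` ({..<2 ^ k} \<times> {..<2 ^ k}) \<subseteq> {p. length p < 2 * k}"
    using P by auto
  moreover have "finite {p :: bool list. length p < 2 * k}"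
    using finite_lists_length_le[of "UNIV :: bool set" "2 * k"]
    by (rule finite_subset[rotated]) auto
  ultimately have "card ({..<(2::nat) ^ k} \<times> {..<(2::nat) ^ k}) \<le> card {p :: bool list. length p < 2 * k}"
    by (rule card_inj_on_le)
  then have "2 ^ k * 2 ^ k \<le> card {p :: bool list. length p < 2 * k}"
    by (simp add: card_cartesian_product)
  also have "\<dots> < 2 ^ (2 * k)" by (rule card_short_strings)
  finally show False by (simp add: mult_2 power_add)
qed

text \<open>Windows for different exponents are disjoint, so an element determines its
  \<open>k\<close> and its offset.\<close>

lemma mem_complex_set_iff:
  assumes "m < 2 ^ k"
  shows "2 * 2 ^ k + m \<in> complex_set U \<longleftrightarrow> (\<forall>j'\<le>m. \<forall>i<2 ^ k. certified U k j' i)"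
proof
  have doubling: "2 * 2 ^ r + s < 2 * 2 ^ t" if "r < t" "s < 2 ^ r" for r s t :: nat
  proof -
    have "(2::nat) ^ Suc r \<le> 2 ^ t" using that by (intro power_increasing) auto
    then show ?thesis using that by simp
  qed
  assume "2 * 2 ^ k + m \<in> complex_set U"
  then obtain l j where j: "j < 2 ^ l" "2 * 2 ^ k + m = 2 * 2 ^ l + j"
    and cert: "\<forall>j'\<le>j. \<forall>i<2 ^ l. certified U l j' i"
    by (auto simp: complex_set_def)
  have "k = l"
    using doubling[of k l m] doubling[of l k j] j assms by (cases k l rule: linorder_cases) auto
  then show "\<forall>j'\<le>m. \<forall>i<2 ^ k. certified U k j' i" using j cert by simp
qed (use assms in \<open>auto simp: complex_set_def\<close>)

text \<open>Take the least \<open>j\<close> that has an uncertified pair \<open>(j, i)\<close>. On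
  the window the set reads \<open>j\<close> ones followed by zeros, so the prefix selected by
  \<open>i\<close> is marked and has no short program.\<close>

lemma complexity_prefix_complex_set:
  "\<exists>n. 3 * 2 ^ k \<le> n \<and> n < 4 * 2 ^ k \<and>
     enat (2 * k) \<le> complexity U (char_prefix (complex_set U) n)"
proof -
  define Q where "Q j \<longleftrightarrow> (\<forall>i<2 ^ k. certified U k j i)" for j
  define j where "j = (LEAST j. \<not> Q j)"
  obtain j0 where j0: "j0 < 2 ^ k" "\<not> Q j0" using uncertified_exists Q_def by metis
  have "\<not> Q j" unfolding j_def by (rule LeastI[of "\<lambda>j. \<not> Q j"]) (rule j0)
  then obtain i where i: "i < 2 ^ k" "\<not> certified U k j i" by (auto simp: Q_def)
  have "j \<le> j0" unfolding j_def by (rule Least_le) (rule j0)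
  have Q: "Q m" if "m < j" for m using that not_less_Least unfolding j_def by blast
  have mem: "2 * 2 ^ k + m \<in> complex_set U \<longleftrightarrow> m < j" if "m < 2 ^ k" for m
    unfolding mem_complex_set_iff[OF that] Q_def[symmetric]
    using Q \<open>\<not> Q j\<close> by (meson le_less_trans not_le)
  \<comment> \<open>\<open>char_prefix\<close> includes its end position, which matches the
    \<open>Suc\<close> in the length required by \<open>marked\<close>.\<close>
  have "marked k j i (char_prefix (complex_set U) (3 * 2 ^ k + i))"
    by (simp add: marked_def char_prefix_def mem del: upt_Suc)
  then have "2 * k \<le> length p"
    if "U (p, []) = Some (Str (char_prefix (complex_set U) (3 * 2 ^ k + i)))" for p
    using i(2) that unfolding certified_def by (meson not_less)
  then have "enat (2 * k) \<le> complexity U (char_prefix (complex_set U) (3 * 2 ^ k + i))"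
    unfolding complexity_def by (intro Inf_greatest) auto
  then show ?thesis using i(1) by (intro exI[of _ "3 * 2 ^ k + i"]) simp
qed

text \<open>Replacing halting by a stage of the approximation leaves only bounded quantifiers
  besides the stage, so the set is a projection of a decidable relation.\<close>

lemma recursively_enumerable_complex_set:
  assumes "partial_recursive U"
  shows "recursively_enumerable (complex_set U)"
proof -
  obtain e where e: "\<And>p q. recf_val e [string_code p, string_code q] = map_option outcome_code (U (p, q))"
    using assms by (auto simp: partial_recursive_def)
  obtain T where T: "approximates (Suc (Suc 0)) T e" using approximates_exists by blast
  define M where "M k j i y \<longleftrightarrow> 2 ^ Suc (3 * 2 ^ k + i) \<le> y \<and> y < 2 ^ Suc (Suc (3 * 2 ^ k + i)) \<and>
     (\<forall>m<2 ^ k. bit y (2 * 2 ^ k + m) \<longleftrightarrow> m < j)" for k j i y :: nat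
  \<comment> \<open>Codes below \<open>2 ^ (2 * k) - 1\<close> are those of programs shorter than
    \<open>2 * k\<close>; the second argument 0 codes the empty string.\<close>
  have certified_iff:
    "certified U k j i \<longleftrightarrow> (\<exists>c<2 ^ (2 * k) - 1. \<exists>y. recf_val e [c, 0] = Some y \<and> M k j i y)" for k j i
  proof
    assume "certified U k j i"
    then obtain p x where p: "length p < 2 * k" "U (p, []) = Some (Str x)" "marked k j i x"
      by (auto simp: certified_def)
    then have "recf_val e [string_code p, 0] = Some (Suc (string_code x))"
      using e[of p "[]"] by simp
    moreover have "string_code p < 2 ^ (2 * k) - 1"
      using p(1) by (simp add: length_less_iff_string_code)
    moreover have "M k j i (Suc (string_code x))"
      using p(3) unfolding marked_iff_bits M_def .
    ultimately show "\<exists>c<2 ^ (2 * k) - 1. \<exists>y. recf_val e [c, 0] = Some y \<and> M k j i y" by blast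
  next
    assume "\<exists>c<2 ^ (2 * k) - 1. \<exists>y. recf_val e [c, 0] = Some y \<and> M k j i y"
    then obtain c y where c: "c < 2 ^ (2 * k) - 1" "recf_val e [c, 0] = Some y" "M k j i y"
      by blast
    obtain p where p: "string_code p = c" using string_code_surj by blast
    then have "map_option outcome_code (U (p, [])) = Some y"
      using e[of p "[]"] c(2) by simp
    then obtain z where z: "U (p, []) = Some z" "outcome_code z = y" by auto
    \<comment> \<open>The code 0 is that of \<open>Bot\<close>; the lower bound in \<open>M\<close>
      excludes it.\<close>
    have "y \<noteq> 0" using c(3) by (auto simp: M_def)
    then obtain x where x: "z = Str x" using z(2) by (cases z) auto
    then have "marked k j i x" using c(3) z(2) unfolding marked_iff_bits M_def by simp
    moreover have "length p < 2 * k"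
      using c(1) p by (simp add: length_less_iff_string_code)
    ultimately show "certified U k j i" using z(1) x by (auto simp: certified_def)
  qed
  \<comment> \<open>There are two shifts: \<open>T\<close> adds one for halting and
    \<open>outcome_code\<close> adds one for \<open>Str\<close>. Only the first is removed before
    \<open>M\<close> is applied.\<close>
  define S where "S s k j i \<longleftrightarrow>
      (\<exists>c<2 ^ (2 * k) - 1. 0 < T [s, c, 0] \<and> M k j i (T [s, c, 0] - 1))" for s k j i
  have S_sound: "certified U k j i" if "S s k j i" for s k j i
  proof -
    obtain c where c: "c < 2 ^ (2 * k) - 1" "0 < T [s, c, 0]" "M k j i (T [s, c, 0] - 1)"
      using \<open>S s k j i\<close> by (auto simp: S_def)
    have "recf_val e [c, 0] = Some (T [s, c, 0] - 1)"
      by (rule approximates_sound[OF T, of _ s]) (use c(2) in auto)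
    then show ?thesis using c certified_iff by blast
  qed
  have S_complete: "\<forall>\<^sub>F s in sequentially. S s k j i" if "certified U k j i" for k j i
  proof -
    obtain c y where c: "c < 2 ^ (2 * k) - 1" "recf_val e [c, 0] = Some y" "M k j i y"
      using \<open>certified U k j i\<close> unfolding certified_iff by blast
    have "\<forall>\<^sub>F s in sequentially. T [s, c, 0] = Suc y"
      by (rule approximates_complete[OF T _ c(2)]) simp
    then show ?thesis
      by eventually_elim (use c in \<open>auto simp: S_def\<close>)
  qed
  \<comment> \<open>The search for \<open>k\<close> can be bounded because
    \<open>k < 2 ^ k \<le> a\<close>.\<close>
  define R where "R s a \<longleftrightarrow> (\<exists>k<Suc a. \<exists>j<2 ^ k. a = 2 * 2 ^ k + j \<and>
      (\<forall>j'<Suc j. \<forall>i<2 ^ k. S s k j' i))" for s a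
  have "decidable (Suc (Suc 0)) (\<lambda>xs. R (hd xs) (hd (tl xs)))"
    unfolding R_def S_def M_def
    by (intro total_recursive_intros decidable_bit
        total_recursive_compose[OF approximates_recursive[OF T]])
      (rule total_recursive_list_id)+
  then have "recursively_enumerable {a. \<exists>s. R s a}" by (rule recursively_enumerable_projection)
  also have "{a. \<exists>s. R s a} = complex_set U"
  proof (intro set_eqI iffI)
    fix a assume "a \<in> {a. \<exists>s. R s a}"
    then show "a \<in> complex_set U"
      unfolding R_def complex_set_def less_Suc_eq_le using S_sound by blast
  next
    fix a assume "a \<in> complex_set U"
    then obtain k j where j: "j < 2 ^ k" "a = 2 * 2 ^ k + j"
      and cert: "\<forall>j'\<le>j. \<forall>i<2 ^ k. certified U k j' i"
      by (auto simp: complex_set_def)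
    \<comment> \<open>Only finitely many pairs must be certified, so a single stage serves all of
      them.\<close>
    have "\<forall>\<^sub>F s in sequentially. \<forall>j'\<in>{..j}. \<forall>i\<in>{..<2 ^ k}. S s k j' i"
      using cert by (intro eventually_ball_finite ballI S_complete) auto
    then obtain s where "\<forall>j'\<in>{..j}. \<forall>i\<in>{..<2 ^ k}. S s k j' i"
      by (auto dest: eventually_happens)
    moreover have "k < 2 ^ k" by (rule less_exp)
    then have "k < Suc a" using j(2) by linarith
    ultimately have "R s a" unfolding R_def using j by (auto simp: less_Suc_eq_le)
    then show "a \<in> {a. \<exists>s. R s a}" by blast
  qed
  finally show ?thesis .
qed

theorem theorem2p1:
  fixes U :: "bool list \<times> bool list \<rightharpoonup> outcome"
  assumes "optimal U"
  shows "\<exists>A :: nat set. recursively_enumerable A \<and>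
    (\<exists>c :: real. infinite {n :: nat.
       ereal_of_enat (complexity U (char_prefix A n)) \<ge> ereal (2 * log 2 (real n) - c)})"
proof (intro exI conjI)
  show "recursively_enumerable (complex_set U)"
    using assms by (intro recursively_enumerable_complex_set) (simp add: optimal_def)
  \<comment> \<open>The constant is 4 because \<open>n < 4 * 2 ^ k\<close> gives
    \<open>log 2 n \<le> k + 2\<close>, hence \<open>2 * log 2 n - 4 \<le> 2 * k\<close>.\<close>
  show "infinite {n. ereal_of_enat (complexity U (char_prefix (complex_set U) n)) \<ge>
      ereal (2 * log 2 (real n) - 4)}"
  proof (rule infinite_nat_iff_unbounded_le[THEN iffD2], rule allI)
    fix k :: nat
    obtain n where n: "3 * 2 ^ k \<le> n" "n < 4 * 2 ^ k"
      and C: "enat (2 * k) \<le> complexity U (char_prefix (complex_set U) n)"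
      using complexity_prefix_complex_set by metis
    have "k < 2 ^ k" by (rule less_exp)
    then have "k \<le> n" using n(1) by linarith
    have "0 < n" using n(1) by (rule less_le_trans[rotated]) simp
    have "real n \<le> real (4 * 2 ^ k)" using n(2) by (simp only: of_nat_le_iff less_imp_le)
    also have "\<dots> = 2 powr (real k + 2)" by (simp add: powr_add powr_realpow)
    finally have "real n \<le> 2 powr (real k + 2)" .
    then have "log 2 (real n) \<le> real k + 2"
      using \<open>0 < n\<close> by (simp add: log_le_iff)
    then have "ereal (2 * log 2 (real n) - 4) \<le> ereal_of_enat (enat (2 * k))" by simp
    also have "\<dots> \<le> ereal_of_enat (complexity U (char_prefix (complex_set U) n))"
      using C by (simp only: ereal_of_enat_le_iff)
    finally show "\<exists>n\<ge>k. n \<in> {n. ereal_of_enat (complexity U (char_prefix (complex_set U) n)) \<ge>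
        ereal (2 * log 2 (real n) - 4)}"
      using \<open>k \<le> n\<close> by blast
  qed
qed

end
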